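(* Let $A$ be a $C^*$-algebra, $X$ a Hilbert $A$-module, $\mathcal{H},\mathcal{K}$ Hilbert spaces, $\varphi:A\to L(\mathcal{H})$ a completely positive linear map, $\Phi:X\to L(\mathcal{H},\mathcal{K})$ a $\varphi$-map and $((\Pi_\Phi,\pi_\varphi),(W_\Phi,V_\varphi),(\mathcal{H}_\varphi,\mathcal{K}_\Phi))$ a minimal Stinespring representation associated with $(\varphi,\Phi)$. Then for $x\in X$ the following statements are equivalent: (1) $x\in X_\varphi$; (2) $\Pi_\Phi(x)\left(\mathrm{id}_{\mathcal{H}_\varphi}-V_\varphi V_\varphi^*\right)=0$; (3) $W_\Phi^*\Pi_\Phi(x)=\Phi(x)V_\varphi^*$; (4) $\Pi_\Phi(x)=W_\Phi\Phi(x)V_\varphi^*$.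
   Context: Hilbert $C^*$-modules are right modules, with inner product linear in the second variable. $L(\mathcal{H},\mathcal{K})$ denotes bounded linear operators, $L(\mathcal{H})=L(\mathcal{H},\mathcal{H})$, and $[\,\cdot\,]$ closed linear span. A map $\Phi:X\to L(\mathcal{H},\mathcal{K})$ is a $\varphi$-map if $\Phi(x)^*\Phi(y)=\varphi(\langle x,y\rangle)$ for all $x,y\in X$; when $\varphi$ is a $*$-homomorphism it is called a $\varphi$-representation. A minimal Stinespring representation associated with $(\varphi,\Phi)$ consists of Hilbert spaces $\mathcal{H}_\varphi,\mathcal{K}_\Phi$, a $*$-representation $\pi_\varphi:A\to L(\mathcal{H}_\varphi)$, a $\pi_\varphi$-representation $\Pi_\Phi:X\to L(\mathcal{H}_\varphi,\mathcal{K}_\Phi)$, a bounded operator $V_\varphi:\mathcal{H}\to\mathcal{H}_\varphi$ and a coisometry $W_\Phi:\mathcal{K}\to\mathcal{K}_\Phi$ such that $\varphi(\cdot)=V_\varphi^*\pi_\varphi(\cdot)V_\varphi$, $[\pi_\varphi(A)V_\varphi\mathcal{H}]=\mathcal{H}_\varphi$, $\Phi(\cdot)=W_\Phi^*\Pi_\Phi(\cdot)V_\varphi$ and $[\Pi_\Phi(X)V_\varphi\mathcal{H}]=\mathcal{K}_\Phi$. Let $M_\varphi=\{a\in A:\varphi(ab)=\varphi(a)\varphi(b),\ \varphi(ba)=\varphi(b)\varphi(a)\ \forall b\in A\}$ and $T_\varphi=\{a\in M_\varphi:\varphi(ba^*c)=\varphi(b)\varphi(a)^*\varphi(c)\ \forall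 b,c\in A\}$. The ternary domain $X_\varphi$ of $\varphi$ on $X$ is the set $\{x\in X:\Phi(xb)=\Phi(x)\varphi(b)\text{ for all }b\in A\}$, where $\Phi$ is any operator-valued $\varphi$-map on $X$ (the set is the same for every choice of $\Phi$; equivalently $X_\varphi=\{x\in X:\langle x,x\rangle\in T_\varphi\}$). *)

theory Defs
  imports "HOL-Analysis.Analysis"
begin

section \<open>Complex normed spaces and Hilbert spaces\<close>

text \<open>
  HOL-Analysis only has real vector spaces as type classes.  The complex classes below extend the
  real ones by a compatible complex scalar multiplication, so that norm, topology, completeness and
  closure are those of the library.
\<close>

class scaleC =
  fixes scaleC :: "complex \<Rightarrow> 'a \<Rightarrow> 'a" (infixr "*\<^sub>C" 75)

class complex_vector = real_vector + scaleC +
  assumes scaleC_add_right: "c *\<^sub>C (x + y) = c *\<^sub>C x + c *\<^sub>C y"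
    and scaleC_add_left: "(c + d) *\<^sub>C x = c *\<^sub>C x + d *\<^sub>C x"
    and scaleC_scaleC: "c *\<^sub>C d *\<^sub>C x = (c * d) *\<^sub>C x"
    and scaleR_scaleC: "r *\<^sub>R x = complex_of_real r *\<^sub>C x"

lemma scaleC_one [simp]: "1 *\<^sub>C x = (x::'a::complex_vector)"
  using scaleR_scaleC[of 1 x] by simp

global_interpretation complex_vector: vector_space "scaleC :: complex \<Rightarrow> 'a \<Rightarrow> 'a::complex_vector"
  defines cspan = complex_vector.span
  by unfold_locales (simp_all add: scaleC_add_right scaleC_add_left scaleC_scaleC)

abbreviation clinear :: "('a::complex_vector \<Rightarrow> 'b::complex_vector) \<Rightarrow> bool"
  where "clinear \<equiv> Vector_Spaces.linear scaleC scaleC"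

class complex_normed_vector = real_normed_vector + complex_vector +
  assumes norm_scaleC [simp]: "norm (c *\<^sub>C x) = cmod c * norm x"

class cbanach = complex_normed_vector + complete_space

class complex_inner = complex_normed_vector +
  fixes cinner :: "'a \<Rightarrow> 'a \<Rightarrow> complex"
  assumes cinner_commute: "cinner x y = cnj (cinner y x)"
    and cinner_add_right: "cinner x (y + z) = cinner x y + cinner x z"
    and cinner_scaleC_right [simp]: "cinner x (c *\<^sub>C y) = c * cinner x y"
    and cinner_self: "cinner x x = complex_of_real ((norm x)\<^sup>2)"

class chilbert_space = complex_inner + complete_space

instance chilbert_space \<subseteq> cbanach ..

instantiation complex :: chilbert_space
begin
definition "c *\<^sub>C (z::complex) = c * z"
definition "cinner (z::complex) w = cnj z * w"
instance
  by standard
    (auto simp: scaleC_complex_def cinner_complex_def algebra_simps norm_mult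
       scaleR_conv_of_real complex_norm_square[symmetric])
end

lemma clinear_iff:
  fixes f :: "'a::complex_vector \<Rightarrow> 'b::complex_vector"
  shows "clinear f \<longleftrightarrow> (\<forall>x y. f (x + y) = f x + f y) \<and> (\<forall>c x. f (c *\<^sub>C x) = c *\<^sub>C f x)"
  unfolding Vector_Spaces.linear_iff
  using complex_vector.vector_space_axioms[where 'a='a] complex_vector.vector_space_axioms[where 'a='b]
  by blast

lemma cinner_add_left: "cinner (x + y) z = cinner x z + cinner (y::'a::complex_inner) z"
  by (metis cinner_commute cinner_add_right complex_cnj_add)

lemma cinner_scaleC_left [simp]: "cinner (c *\<^sub>C x) y = cnj c * cinner (x::'a::complex_inner) y"
  by (metis cinner_commute cinner_scaleC_right complex_cnj_mult)

lemma cinner_zero_right [simp]: "cinner x (0::'a::complex_inner) = 0"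
  using cinner_add_right[of x 0 0] by simp

lemma cinner_zero_left [simp]: "cinner (0::'a::complex_inner) x = 0"
  using cinner_add_left[of 0 0 x] by simp

lemma cinner_minus_right [simp]: "cinner x (- y) = - cinner x (y::'a::complex_inner)"
  using cinner_add_right[of x y "- y"] by (simp add: eq_neg_iff_add_eq_0 add.commute)

lemma cinner_minus_left [simp]: "cinner (- x) y = - cinner x (y::'a::complex_inner)"
  using cinner_add_left[of x "- x" y] by (simp add: eq_neg_iff_add_eq_0 add.commute)

lemma cinner_diff_right: "cinner x (y - z) = cinner x y - cinner x (z::'a::complex_inner)"
  using cinner_add_right[of x y "- z"] by simp

lemma cinner_diff_left: "cinner (x - y) z = cinner x z - cinner (y::'a::complex_inner) z"
  using cinner_add_left[of x "- y" z] by simp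

lemma cinner_eqI:
  assumes "\<And>x. cinner y x = cinner z (x::'a::complex_inner)" shows "y = z"
proof -
  have "cinner (y - z) (y - z) = 0"
    by (simp only: cinner_diff_left assms) simp
  then show ?thesis by (simp add: cinner_self)
qed

lemma Re_cinner_commute: "Re (cinner y x) = Re (cinner (x::'a::complex_inner) y)"
  by (subst cinner_commute) simp

lemma norm_add_sq:
  "(norm (x + y))\<^sup>2 = (norm x)\<^sup>2 + (norm y)\<^sup>2 + 2 * Re (cinner x (y::'a::complex_inner))"
proof -
  have "(norm z)\<^sup>2 = Re (cinner z z)" for z :: 'a by (simp add: cinner_self)
  then show ?thesis
    by (simp add: cinner_add_left cinner_add_right Re_cinner_commute[of y x] del: power2_norm_eq_inner)
qed

lemma cauchy_schwarz: "cmod (cinner x y) \<le> norm x * norm (y::'a::complex_inner)"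
proof (cases "cinner x y = 0")
  case False
  define c where "c = cnj (cinner x y) / of_real (cmod (cinner x y))"
  have c: "cmod c = 1" using False by (simp add: c_def norm_divide)
  have "(norm (x + c *\<^sub>C y))\<^sup>2 \<le> (norm x + norm (c *\<^sub>C y))\<^sup>2"
    by (rule power_mono[OF norm_triangle_ineq]) simp
  then have "Re (cinner x (c *\<^sub>C y)) \<le> norm x * norm y"
    unfolding norm_add_sq by (simp add: c power2_sum)
  moreover have "cinner x (c *\<^sub>C y) = of_real (cmod (cinner x y))"
  proof -
    have "cnj (cinner x y) * cinner x y = of_real ((cmod (cinner x y))\<^sup>2)"
      by (metis complex_norm_square mult.commute of_real_power)
    then show ?thesis using False by (simp add: c_def power2_eq_square)
  qed
  ultimately show ?thesis by (metis Re_complex_of_real)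
qed simp

theorem riesz_representation:
  fixes f :: "'a::chilbert_space \<Rightarrow> complex"
  assumes add: "\<And>x y. f (x + y) = f x + f y" and scale: "\<And>c x. f (c *\<^sub>C x) = c * f x"
    and bound: "\<And>x. cmod (f x) \<le> K * norm x"
  shows "\<exists>z. \<forall>x. f x = cinner z x"
proof -
  define J where "J x = (norm x)\<^sup>2 - 2 * Re (f x)" for x
  have scaleR: "f (r *\<^sub>R x) = of_real r * f x" for r x by (simp add: scaleR_scaleC scale)
  have J_lower: "- (K\<^sup>2) \<le> J x" for x
  proof -
    have "Re (f x) \<le> K * norm x" using bound[of x] complex_Re_le_cmod[of "f x"] by linarith
    moreover have "0 \<le> (norm x - K)\<^sup>2" by simp
    ultimately show ?thesis by (simp add: J_def power2_diff algebra_simps)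
  qed
  then have bdd: "bdd_below (range J)" by (auto intro!: bdd_belowI)
  define m where "m = Inf (range J)"
  have m_le: "m \<le> J x" for x unfolding m_def using bdd by (auto intro: cInf_lower)
  have "\<exists>x. J x < m + 1 / real (Suc n)" for n
    using cInf_lessD[of "range J" "m + 1 / real (Suc n)"] by (auto simp: m_def)
  then obtain u where u: "\<And>n. J (u n) < m + 1 / real (Suc n)" by metis
  have par: "(norm (x - y))\<^sup>2 = 2 * J x + 2 * J y - 4 * J ((1/2) *\<^sub>R (x + y))" for x y
  proof -
    have 1: "(norm (x - y))\<^sup>2 = 2 * (norm x)\<^sup>2 + 2 * (norm y)\<^sup>2 - (norm (x + y))\<^sup>2"
      using norm_add_sq[of x y] norm_add_sq[of x "- y"] by simp
    have 2: "J ((1/2) *\<^sub>R (x + y)) = (norm (x + y))\<^sup>2 / 4 - Re (f x) - Re (f y)"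
      by (simp only: J_def scaleR norm_scaleR add power_mult_distrib Re_complex_of_real
            Im_complex_of_real times_complex.sel plus_complex.sel) (simp add: power2_eq_square field_simps)
    show ?thesis unfolding 1 2 by (simp add: J_def algebra_simps)
  qed
  have close: "(norm (u i - u j))\<^sup>2 \<le> 2 / real (Suc i) + 2 / real (Suc j)" for i j
    using par[of "u i" "u j"] m_le[of "(1/2) *\<^sub>R (u i + u j)"] u[of i] u[of j] by simp
  have "Cauchy u"
  proof (rule metric_CauchyI)
    fix e :: real assume e: "0 < e"
    obtain M where M: "4 / e\<^sup>2 < real M" using reals_Archimedean2 by blast
    show "\<exists>M. \<forall>i\<ge>M. \<forall>j\<ge>M. dist (u i) (u j) < e"
    proof (intro exI allI impI)
      fix i j assume "M \<le> i" "M \<le> j"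
      have b: "2 / real (Suc k) < e\<^sup>2 / 2" if "M \<le> k" for k
      proof -
        have "4 / e\<^sup>2 < real (Suc k)" using M that by linarith
        then show ?thesis using e by (simp add: field_simps)
      qed
      have "(norm (u i - u j))\<^sup>2 < e\<^sup>2"
        using close[of i j] b[OF \<open>M \<le> i\<close>] b[OF \<open>M \<le> j\<close>] by linarith
      then show "dist (u i) (u j) < e"
        using e by (simp add: dist_norm power2_less_imp_less)
    qed
  qed
  then obtain z where z: "u \<longlonglongrightarrow> z" using Cauchy_convergent_iff convergent_def by blast
  have f_lim: "(\<lambda>n. f (u n)) \<longlonglongrightarrow> f z"
  proof -
    have "(\<lambda>n. f (u n - z)) \<longlonglongrightarrow> 0"
    proof (rule Lim_null_comparison[of _ "\<lambda>n. K * norm (u n - z)"])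
      show "\<forall>\<^sub>F n in sequentially. norm (f (u n - z)) \<le> K * norm (u n - z)"
        using bound by simp
      show "(\<lambda>n. K * norm (u n - z)) \<longlonglongrightarrow> 0"
        using tendsto_mult_right_zero[OF tendsto_norm_zero[OF LIM_zero[OF z]]] by simp
    qed
    moreover have "f (u n - z) = f (u n) - f z" for n
      using add[of "u n - z" z] by simp
    ultimately show ?thesis by (simp add: LIM_zero_iff)
  qed
  have "(\<lambda>n. J (u n)) \<longlonglongrightarrow> J z"
    unfolding J_def by (intro tendsto_intros z f_lim)
  moreover have "(\<lambda>n. m + 1 / real (Suc n)) \<longlonglongrightarrow> m + 0"
    by (intro tendsto_intros LIMSEQ_Suc lim_1_over_n)
  ultimately have Jz: "J z \<le> m" using u
    by (metis (no_types, lifting) LIMSEQ_le add_0_right less_imp_le)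
  have Re_eq: "Re (f w) = Re (cinner z w)" for w
  proof (rule ccontr)
    assume neq: "Re (f w) \<noteq> Re (cinner z w)"
    define d where "d = Re (cinner z w) - Re (f w)"
    define t where "t = - d / ((norm w)\<^sup>2 + 1)"
    have pos: "(norm w)\<^sup>2 + 1 > 0" by (simp add: add_nonneg_pos)
    have "J (z + t *\<^sub>R w) = J z + t\<^sup>2 * (norm w)\<^sup>2 + 2 * t * d"
      unfolding J_def norm_add_sq add scaleR
      by (simp add: d_def power_mult_distrib scaleR_scaleC algebra_simps)
    then have "0 \<le> t\<^sup>2 * (norm w)\<^sup>2 + 2 * t * d"
      using Jz m_le[of "z + t *\<^sub>R w"] by linarith
    moreover have "t\<^sup>2 * ((norm w)\<^sup>2 + 1) + t * d = 0"
    proof -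
      have "t * ((norm w)\<^sup>2 + 1) = - d" using pos by (simp add: t_def)
      then have "t * (t * ((norm w)\<^sup>2 + 1)) + t * d = 0" by simp
      then show ?thesis unfolding power2_eq_square[of t] by (simp only: mult.assoc)
    qed
    moreover have "t * d < 0"
      using neq pos by (simp add: t_def d_def divide_neg_pos mult_less_0_iff zero_less_mult_iff
            linorder_neq_iff divide_less_0_iff zero_less_divide_iff) linarith
    moreover have "0 \<le> t\<^sup>2" by simp
    ultimately show False by (simp add: algebra_simps)
  qed
  have "f w = cinner z w" for w
  proof (rule complex_eqI)
    show "Re (f w) = Re (cinner z w)" by (rule Re_eq)
    show "Im (f w) = Im (cinner z w)" using Re_eq[of "\<i> *\<^sub>C w"] by (simp add: scale)
  qed
  then show ?thesis by blast
qed


section \<open>Bounded operators\<close>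

text \<open>
  The library type \<open>'a \<Rightarrow>\<^sub>L 'b\<close> consists of bounded real-linear maps; \<open>L(\<H>, \<K>)\<close> requires
  complex linearity.
\<close>

typedef (overloaded) ('a::complex_normed_vector, 'b::complex_normed_vector) cop
    ("(_ \<Rightarrow>\<^sub>C\<^sub>L /_)" [22, 21] 21) =
  "{f :: 'a \<Rightarrow> 'b. clinear f \<and> (\<exists>K. \<forall>x. norm (f x) \<le> norm x * K)}"
  morphisms cop_apply Cop
proof
  show "(\<lambda>_. 0) \<in> {f :: 'a \<Rightarrow> 'b. clinear f \<and> (\<exists>K. \<forall>x. norm (f x) \<le> norm x * K)}"
    by (auto simp: clinear_iff intro: exI[of _ 0])
qed

setup_lifting type_definition_cop

declare [[coercion "cop_apply :: ('a::complex_normed_vector \<Rightarrow>\<^sub>C\<^sub>L 'b::complex_normed_vector) \<Rightarrow> 'a \<Rightarrow> 'b"]]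

lemma cop_eqI: "(\<And>x. cop_apply S x = cop_apply T x) \<Longrightarrow> S = T"
  by transfer auto

lemma cop_eq_iff: "S = T \<longleftrightarrow> (\<forall>x. cop_apply S x = cop_apply T x)"
  by (auto intro: cop_eqI)

lemma cop_add [simp]: "cop_apply T (x + y) = T x + T y"
  by transfer (simp add: clinear_iff)

lemma cop_scaleC [simp]: "cop_apply T (c *\<^sub>C x) = c *\<^sub>C T x"
  by transfer (simp add: clinear_iff)

lemma cop_bounded: "\<exists>K\<ge>0. \<forall>x. norm (cop_apply T x) \<le> norm x * K"
proof -
  obtain K where "\<forall>x. norm (cop_apply T x) \<le> norm x * K" by transfer auto
  then have "\<forall>x. norm (cop_apply T x) \<le> norm x * \<bar>K\<bar>"
    by (meson abs_ge_self mult_left_mono norm_ge_zero order_trans)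
  then show ?thesis by (intro exI[of _ "\<bar>K\<bar>"]) simp
qed

lemma neg_one_scaleC: "(- 1) *\<^sub>C x = - (x::'a::complex_vector)"
  using scaleR_scaleC[of "- 1" x] by simp

instantiation cop :: (complex_normed_vector, complex_normed_vector) complex_vector
begin

lift_definition zero_cop :: "'a \<Rightarrow>\<^sub>C\<^sub>L 'b" is "\<lambda>_. 0"
  by (auto simp: clinear_iff intro: exI[of _ 0])

lift_definition plus_cop :: "('a \<Rightarrow>\<^sub>C\<^sub>L 'b) \<Rightarrow> ('a \<Rightarrow>\<^sub>C\<^sub>L 'b) \<Rightarrow> ('a \<Rightarrow>\<^sub>C\<^sub>L 'b)"
  is "\<lambda>S T x. S x + T x"
proof (safe)
  fix S T :: "'a \<Rightarrow> 'b" and K L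
  assume "clinear S" "clinear T"
  then show "clinear (\<lambda>x. S x + T x)" by (simp add: clinear_iff scaleC_add_right algebra_simps)
  assume "\<forall>x. norm (S x) \<le> norm x * K" "\<forall>x. norm (T x) \<le> norm x * L"
  then show "\<exists>K. \<forall>x. norm (S x + T x) \<le> norm x * K"
    by (intro exI[of _ "K + L"]) (simp add: norm_triangle_mono distrib_left)
qed

lift_definition scaleC_cop :: "complex \<Rightarrow> ('a \<Rightarrow>\<^sub>C\<^sub>L 'b) \<Rightarrow> ('a \<Rightarrow>\<^sub>C\<^sub>L 'b)" is "\<lambda>c T x. c *\<^sub>C T x"
proof (safe)
  fix c and T :: "'a \<Rightarrow> 'b" and K
  assume "clinear T"
  then show "clinear (\<lambda>x. c *\<^sub>C T x)"
    by (simp add: clinear_iff scaleC_add_right scaleC_scaleC mult.commute)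
  assume "\<forall>x. norm (T x) \<le> norm x * K"
  then have "cmod c * norm (T x) \<le> cmod c * (norm x * K)" for x
    by (simp add: mult_left_mono)
  then show "\<exists>K. \<forall>x. norm (c *\<^sub>C T x) \<le> norm x * K"
    by (intro exI[of _ "cmod c * K"]) (simp add: mult.left_commute)
qed

definition "r *\<^sub>R (T :: 'a \<Rightarrow>\<^sub>C\<^sub>L 'b) = complex_of_real r *\<^sub>C T"
definition "- (T :: 'a \<Rightarrow>\<^sub>C\<^sub>L 'b) = (- 1) *\<^sub>C T"
definition "(S :: 'a \<Rightarrow>\<^sub>C\<^sub>L 'b) - T = S + - T"

lemmas cop_rep_eq = zero_cop.rep_eq plus_cop.rep_eq scaleC_cop.rep_eq

instance
proof
  fix r s :: real and c d :: complex and S T U :: "'a \<Rightarrow>\<^sub>C\<^sub>L 'b"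
  show "S + T + U = S + (T + U)" by (rule cop_eqI) (simp add: cop_rep_eq add.assoc)
  show "S + T = T + S" by (rule cop_eqI) (simp add: cop_rep_eq add.commute)
  show "0 + S = S" by (rule cop_eqI) (simp add: cop_rep_eq)
  show "- S + S = 0" by (rule cop_eqI) (simp add: cop_rep_eq uminus_cop_def neg_one_scaleC)
  show "S - T = S + - T" by (rule minus_cop_def)
  show 1: "c *\<^sub>C (S + T) = c *\<^sub>C S + c *\<^sub>C T" for c
    by (rule cop_eqI) (simp add: cop_rep_eq scaleC_add_right)
  show 2: "(c + d) *\<^sub>C S = c *\<^sub>C S + d *\<^sub>C S" for c d
    by (rule cop_eqI) (simp add: cop_rep_eq scaleC_add_left)
  show 3: "c *\<^sub>C d *\<^sub>C S = (c * d) *\<^sub>C S" for c d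
    by (rule cop_eqI) (simp add: cop_rep_eq scaleC_scaleC)
  show "r *\<^sub>R S = complex_of_real r *\<^sub>C S" by (rule scaleR_cop_def)
  show "r *\<^sub>R (S + T) = r *\<^sub>R S + r *\<^sub>R T" unfolding scaleR_cop_def by (rule 1)
  show "(r + s) *\<^sub>R S = r *\<^sub>R S + s *\<^sub>R S" unfolding scaleR_cop_def of_real_add by (rule 2)
  show "r *\<^sub>R s *\<^sub>R S = (r * s) *\<^sub>R S" unfolding scaleR_cop_def of_real_mult by (rule 3)
  show "1 *\<^sub>R S = S" by (rule cop_eqI) (simp add: scaleR_cop_def cop_rep_eq)
qed

end

lemma plus_cop_apply [simp]: "cop_apply (S + T) x = S x + T x"
  by (simp add: plus_cop.rep_eq)

lemma scaleC_cop_apply [simp]: "cop_apply (c *\<^sub>C T) x = c *\<^sub>C T x"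
  by (simp add: scaleC_cop.rep_eq)

lemma zero_cop_apply [simp]: "cop_apply 0 x = 0"
  by (simp add: zero_cop.rep_eq)

lemma uminus_cop_apply [simp]: "cop_apply (- T) x = - T x"
  unfolding uminus_cop_def scaleC_cop_apply by (rule neg_one_scaleC)

lemma minus_cop_apply [simp]: "cop_apply (S - T) x = S x - T x"
  unfolding minus_cop_def plus_cop_apply uminus_cop_apply by simp

lift_definition id_cop :: "'a::complex_normed_vector \<Rightarrow>\<^sub>C\<^sub>L 'a" is "\<lambda>x. x"
  by (auto simp: clinear_iff intro: exI[of _ 1])

lift_definition cop_compose ::
    "('b::complex_normed_vector \<Rightarrow>\<^sub>C\<^sub>L 'c::complex_normed_vector) \<Rightarrow>
     ('a::complex_normed_vector \<Rightarrow>\<^sub>C\<^sub>L 'b) \<Rightarrow> ('a \<Rightarrow>\<^sub>C\<^sub>L 'c)" (infixl "o\<^sub>C\<^sub>L" 67)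
  is "\<lambda>S T x. S (T x)"
proof (safe)
  fix S :: "'b \<Rightarrow> 'c" and T :: "'a \<Rightarrow> 'b" and K L
  assume "clinear S" "clinear T"
  then show "clinear (\<lambda>x. S (T x))" by (simp add: clinear_iff)
  assume S: "\<forall>x. norm (S x) \<le> norm x * K" and T: "\<forall>x. norm (T x) \<le> norm x * L"
  show "\<exists>K. \<forall>x. norm (S (T x)) \<le> norm x * K"
  proof (intro exI allI)
    fix x
    have "norm (S (T x)) \<le> norm (T x) * K" using S by blast
    also have "\<dots> \<le> norm (T x) * \<bar>K\<bar>" by (simp add: mult_left_mono)
    also have "\<dots> \<le> (norm x * L) * \<bar>K\<bar>" using T by (simp add: mult_right_mono)
    finally show "norm (S (T x)) \<le> norm x * (L * \<bar>K\<bar>)" by (simp add: mult.assoc)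
  qed
qed

lemma id_cop_apply [simp]: "cop_apply id_cop x = x"
  by transfer simp

lemma cop_compose_apply [simp]: "cop_apply (S o\<^sub>C\<^sub>L T) x = S (T x)"
  by transfer simp

definition adj :: "('a::chilbert_space \<Rightarrow>\<^sub>C\<^sub>L 'b::chilbert_space) \<Rightarrow> ('b \<Rightarrow>\<^sub>C\<^sub>L 'a)" ("_\<^sup>\<dagger>" [1000] 999)
  where "T\<^sup>\<dagger> = (THE S :: 'b \<Rightarrow>\<^sub>C\<^sub>L 'a. \<forall>x y. cinner (S y) x = cinner y (T x))"

lemma adj_exists:
  fixes T :: "'a::chilbert_space \<Rightarrow>\<^sub>C\<^sub>L 'b::chilbert_space"
  shows "\<exists>S :: 'b \<Rightarrow>\<^sub>C\<^sub>L 'a. \<forall>x y. cinner (S y) x = cinner y (T x)"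
proof -
  obtain K where K: "K \<ge> 0" "\<And>x. norm (T x) \<le> norm x * K" using cop_bounded[of T] by auto
  have "\<exists>z. \<forall>x. cinner y (T x) = cinner z x" for y
  proof (rule riesz_representation[of _ "norm y * K"])
    fix x x' c
    show "cinner y (T (x + x')) = cinner y (T x) + cinner y (T x')" by (simp add: cinner_add_right)
    show "cinner y (T (c *\<^sub>C x)) = c * cinner y (T x)" by simp
    have "cmod (cinner y (T x)) \<le> norm y * norm (T x)" by (rule cauchy_schwarz)
    also have "\<dots> \<le> norm y * (norm x * K)" by (simp add: K(2) mult_left_mono)
    finally show "cmod (cinner y (T x)) \<le> norm y * K * norm x" by (simp add: ac_simps)
  qed
  then obtain S where S: "\<And>x y. cinner (S y) x = cinner y (T x)"
    using choice[of "\<lambda>y z. \<forall>x. cinner y (T x) = cinner z x"] by auto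
  have "clinear S"
    unfolding clinear_iff
  proof (intro conjI allI)
    show "S (y + y') = S y + S y'" for y y'
      by (rule cinner_eqI) (simp add: S cinner_add_left)
    show "S (c *\<^sub>C y) = c *\<^sub>C S y" for c y
      by (rule cinner_eqI) (simp add: S)
  qed
  moreover have "norm (S y) \<le> norm y * K" for y
  proof (cases "S y = 0")
    case False
    have "(norm (S y))\<^sup>2 = cmod (cinner y (T (S y)))"
      unfolding S[of y "S y", symmetric] cinner_self by (simp add: norm_power)
    also have "\<dots> \<le> norm y * norm (T (S y))" by (rule cauchy_schwarz)
    also have "\<dots> \<le> norm y * (norm (S y) * K)" by (simp add: K(2) mult_left_mono)
    finally have "norm (S y) * norm (S y) \<le> (norm y * K) * norm (S y)"
      by (simp add: power2_eq_square ac_simps)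
    with False show ?thesis by (simp add: mult_le_cancel_right)
  qed (simp add: K(1))
  ultimately have "cop_apply (Cop S) = S" by (intro Cop_inverse) auto
  with S have "\<forall>x y. cinner (cop_apply (Cop S) y) x = cinner y (T x)" by simp
  then show ?thesis ..
qed

lemma cinner_adj:
  fixes T :: "'a::chilbert_space \<Rightarrow>\<^sub>C\<^sub>L 'b::chilbert_space"
  shows "cinner ((T\<^sup>\<dagger>) y) x = cinner y (cop_apply T x)"
proof -
  have "\<exists>!S :: 'b \<Rightarrow>\<^sub>C\<^sub>L 'a. \<forall>x y. cinner (S y) x = cinner y (T x)"
  proof (rule ex_ex1I[OF adj_exists])
    fix S S' :: "'b \<Rightarrow>\<^sub>C\<^sub>L 'a"
    assume "\<forall>x y. cinner (S y) x = cinner y (T x)" "\<forall>x y. cinner (S' y) x = cinner y (T x)"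
    then show "S = S'" by - (rule cop_eqI, rule cinner_eqI, simp)
  qed
  from theI'[OF this] show ?thesis by (simp add: adj_def)
qed


section \<open>C*-algebras and Hilbert modules\<close>

text \<open>No unit is assumed: \<^class>\<open>real_normed_algebra\<close> does not have one.\<close>

class cstar_algebra = cbanach + real_normed_algebra +
  fixes star :: "'a \<Rightarrow> 'a"
  assumes scaleC_mult_left: "(c *\<^sub>C a) * b = c *\<^sub>C (a * b)"
    and scaleC_mult_right: "a * (c *\<^sub>C b) = c *\<^sub>C (a * b)"
    and star_star [simp]: "star (star a) = a"
    and star_add: "star (a + b) = star a + star b"
    and star_scaleC: "star (c *\<^sub>C a) = cnj c *\<^sub>C star a"
    and star_mult: "star (a * b) = star b * star a"
    and norm_star_mult_self: "norm (star a * a) = (norm a)\<^sup>2"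

instantiation complex :: cstar_algebra
begin
definition "star (z::complex) = cnj z"
instance
  by standard (auto simp: scaleC_complex_def star_complex_def norm_mult power2_eq_square)
end

definition cstar_positive :: "'a::cstar_algebra \<Rightarrow> bool"
  where "cstar_positive a \<longleftrightarrow> (\<exists>b. a = star b * b)"

text \<open>
  The class \<^class>\<open>cbanach\<close> supplies norm and completeness of the module; \<open>norm_eq\<close> makes
  this norm the one given by the \<open>A\<close>-valued inner product.
\<close>

locale hilbert_module =
  fixes act :: "'x::cbanach \<Rightarrow> 'a::cstar_algebra \<Rightarrow> 'x"
    and ip :: "'x \<Rightarrow> 'x \<Rightarrow> 'a"
  assumes act_add_left: "act (x + y) a = act x a + act y a"
    and act_add_right: "act x (a + b) = act x a + act x b"
    and act_mult: "act x (a * b) = act (act x a) b"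
    and act_scaleC_left: "act (c *\<^sub>C x) a = c *\<^sub>C act x a"
    and act_scaleC_right: "act x (c *\<^sub>C a) = c *\<^sub>C act x a"
    and ip_add_right: "ip x (y + z) = ip x y + ip x z"
    and ip_scaleC_right: "ip x (c *\<^sub>C y) = c *\<^sub>C ip x y"
    and ip_act_right: "ip x (act y a) = ip x y * a"
    and ip_star: "star (ip x y) = ip y x"
    and ip_positive: "cstar_positive (ip x x)"
    and ip_definite: "ip x x = 0 \<Longrightarrow> x = 0"
    and norm_eq: "norm x = sqrt (norm (ip x x))"


section \<open>Completely positive maps, module maps and Stinespring representations\<close>

text \<open>
  An \<open>n \<times> n\<close> matrix is a function on pairs of indices, of which only those below \<open>n\<close> matter.
  Positivity in the C*-algebra \<open>M\<^sub>n(A)\<close> is being of the form \<open>b\<^sup>* b\<close>, as in \<^const>\<open>cstar_positive\<close>;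
  positivity in \<open>M\<^sub>n(L(\<H>)) = L(\<H>\<^sup>n)\<close> is positivity of an operator on the Hilbert space \<open>\<H>\<^sup>n\<close>.
\<close>

definition matrix_positive :: "nat \<Rightarrow> (nat \<Rightarrow> nat \<Rightarrow> 'a::cstar_algebra) \<Rightarrow> bool"
  where "matrix_positive n a \<longleftrightarrow>
    (\<exists>b. \<forall>i<n. \<forall>j<n. a i j = (\<Sum>k<n. star (b k i) * b k j))"

definition op_matrix_positive :: "nat \<Rightarrow> (nat \<Rightarrow> nat \<Rightarrow> 'h::chilbert_space \<Rightarrow>\<^sub>C\<^sub>L 'h) \<Rightarrow> bool"
  where "op_matrix_positive n T \<longleftrightarrow>
    (\<forall>h. (\<Sum>i<n. \<Sum>j<n. cinner (h i) (cop_apply (T i j) (h j))) \<in> \<real>\<^sub>\<ge>\<^sub>0)"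

definition completely_positive :: "('a::cstar_algebra \<Rightarrow> ('h::chilbert_space \<Rightarrow>\<^sub>C\<^sub>L 'h)) \<Rightarrow> bool"
  where "completely_positive \<phi> \<longleftrightarrow>
    (\<forall>n a. matrix_positive n a \<longrightarrow> op_matrix_positive n (\<lambda>i j. \<phi> (a i j)))"

definition star_representation :: "('a::cstar_algebra \<Rightarrow> ('h::chilbert_space \<Rightarrow>\<^sub>C\<^sub>L 'h)) \<Rightarrow> bool"
  where "star_representation \<pi> \<longleftrightarrow>
    clinear \<pi> \<and> (\<forall>a b. \<pi> (a * b) = \<pi> a o\<^sub>C\<^sub>L \<pi> b) \<and> (\<forall>a. \<pi> (star a) = (\<pi> a)\<^sup>\<dagger>)"

text \<open>
  \<open>\<phi>\<close>-maps and \<open>\<phi>\<close>-representations; linearity in the module variable is a consequence, not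
  part of the definition.
\<close>

definition module_map ::
    "('x \<Rightarrow> 'x \<Rightarrow> 'a) \<Rightarrow> ('a \<Rightarrow> ('h::chilbert_space \<Rightarrow>\<^sub>C\<^sub>L 'h)) \<Rightarrow>
     ('x \<Rightarrow> ('h \<Rightarrow>\<^sub>C\<^sub>L 'k::chilbert_space)) \<Rightarrow> bool"
  where "module_map ip \<phi> \<Phi> \<longleftrightarrow> (\<forall>x y. (\<Phi> x)\<^sup>\<dagger> o\<^sub>C\<^sub>L \<Phi> y = \<phi> (ip x y))"

definition module_representation ::
    "('x \<Rightarrow> 'x \<Rightarrow> 'a::cstar_algebra) \<Rightarrow> ('a \<Rightarrow> ('h::chilbert_space \<Rightarrow>\<^sub>C\<^sub>L 'h)) \<Rightarrow>
     ('x \<Rightarrow> ('h \<Rightarrow>\<^sub>C\<^sub>L 'k::chilbert_space)) \<Rightarrow> bool"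
  where "module_representation ip \<pi> P \<longleftrightarrow> star_representation \<pi> \<and> module_map ip \<pi> P"

definition coisometry :: "('h::chilbert_space \<Rightarrow>\<^sub>C\<^sub>L 'k::chilbert_space) \<Rightarrow> bool"
  where "coisometry W \<longleftrightarrow> W o\<^sub>C\<^sub>L W\<^sup>\<dagger> = id_cop"

definition minimal_stinespring ::
    "('x \<Rightarrow> 'x \<Rightarrow> 'a::cstar_algebra) \<Rightarrow>
     ('a \<Rightarrow> ('h::chilbert_space \<Rightarrow>\<^sub>C\<^sub>L 'h)) \<Rightarrow> ('x \<Rightarrow> ('h \<Rightarrow>\<^sub>C\<^sub>L 'k::chilbert_space)) \<Rightarrow>
     ('x \<Rightarrow> ('hp::chilbert_space \<Rightarrow>\<^sub>C\<^sub>L 'kp::chilbert_space)) \<Rightarrow> ('a \<Rightarrow> ('hp \<Rightarrow>\<^sub>C\<^sub>L 'hp)) \<Rightarrow>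
     ('k \<Rightarrow>\<^sub>C\<^sub>L 'kp) \<Rightarrow> ('h \<Rightarrow>\<^sub>C\<^sub>L 'hp) \<Rightarrow> bool"
  where "minimal_stinespring ip \<phi> \<Phi> P \<pi> W V \<longleftrightarrow>
    module_representation ip \<pi> P \<and>
    coisometry W \<and>
    (\<forall>a. \<phi> a = V\<^sup>\<dagger> o\<^sub>C\<^sub>L \<pi> a o\<^sub>C\<^sub>L V) \<and>
    closure (cspan {\<pi> a (V h) | a h. True}) = UNIV \<and>
    (\<forall>x. \<Phi> x = W\<^sup>\<dagger> o\<^sub>C\<^sub>L P x o\<^sub>C\<^sub>L V) \<and>
    closure (cspan {P x (V h) | x h. True}) = UNIV"

definition ternary_domain ::
    "('x \<Rightarrow> 'a \<Rightarrow> 'x) \<Rightarrow> ('a \<Rightarrow> ('h::chilbert_space \<Rightarrow>\<^sub>C\<^sub>L 'h)) \<Rightarrow>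
     ('x \<Rightarrow> ('h \<Rightarrow>\<^sub>C\<^sub>L 'k::chilbert_space)) \<Rightarrow> 'x set"
  where "ternary_domain act \<phi> \<Phi> = {x. \<forall>b. \<Phi> (act x b) = \<Phi> x o\<^sub>C\<^sub>L \<phi> b}"

text \<open>
  The ternary domain depends only on \<open>\<phi>\<close>, not on the chosen \<open>\<phi>\<close>-map, which may even take values
  in operators into a different Hilbert space.
\<close>

lemma ternary_domain_independent:
  fixes \<Phi> :: "'x \<Rightarrow> ('h::chilbert_space \<Rightarrow>\<^sub>C\<^sub>L 'k::chilbert_space)"
    and \<Psi> :: "'x \<Rightarrow> ('h \<Rightarrow>\<^sub>C\<^sub>L 'l::chilbert_space)"
  assumes \<Phi>: "module_map ip \<phi> \<Phi>" and \<Psi>: "module_map ip \<phi> \<Psi>"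
  shows "ternary_domain act \<phi> \<Phi> = ternary_domain act \<phi> \<Psi>"
proof -
  have ip: "cinner (\<Phi> x h) (\<Phi> y k) = cinner (\<Psi> x h) (\<Psi> y k)" for x y h k
  proof -
    have "cop_apply ((\<Phi> x)\<^sup>\<dagger> o\<^sub>C\<^sub>L \<Phi> y) k = cop_apply ((\<Psi> x)\<^sup>\<dagger> o\<^sub>C\<^sub>L \<Psi> y) k"
      using \<Phi> \<Psi> by (simp add: module_map_def del: cop_compose_apply)
    then have "cinner (((\<Phi> x)\<^sup>\<dagger>) (\<Phi> y k)) h = cinner (((\<Psi> x)\<^sup>\<dagger>) (\<Psi> y k)) h" by simp
    then have "cinner (\<Phi> y k) (\<Phi> x h) = cinner (\<Psi> y k) (\<Psi> x h)" by (simp add: cinner_adj)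
    then show ?thesis by (metis cinner_commute)
  qed
  have eq_iff: "u = v \<longleftrightarrow> cinner u u - cinner u v - cinner v u + cinner v v = 0"
    for u v :: "'z::chilbert_space"
  proof -
    have "cinner (u - v) (u - v) = cinner u u - cinner u v - cinner v u + cinner v v"
      by (simp add: cinner_diff_left cinner_diff_right)
    moreover have "cinner (u - v) (u - v) = 0 \<longleftrightarrow> u = v"
      by (simp add: cinner_self)
    ultimately show ?thesis by simp
  qed
  have "\<Phi> (act x b) h = \<Phi> x (\<phi> b h) \<longleftrightarrow> \<Psi> (act x b) h = \<Psi> x (\<phi> b h)" for x b h
    unfolding eq_iff[of "\<Phi> (act x b) h" "\<Phi> x (\<phi> b h)"]
      eq_iff[of "\<Psi> (act x b) h" "\<Psi> x (\<phi> b h)"] by (simp only: ip)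
  then show ?thesis
    by (simp add: ternary_domain_def cop_eq_iff)
qed

end

theory Submission
  imports Defs
begin

text \<open>
  A representation \<open>P\<close> of the module respects the module action, \<open>P (x b) = P x \<circ> \<pi> b\<close>
  (lemma \<open>module_representation_act\<close>), so that the Stinespring formulas give
  \<open>\<Phi> (x b) - \<Phi> x \<phi> b = W\<^sup>\<dagger> (P x) (id - V V\<^sup>\<dagger>) \<pi> b V\<close>.
  Since \<open>W\<close> is a coisometry, \<open>W\<^sup>\<dagger>\<close> is injective, and since the vectors \<open>\<pi> b (V h)\<close> are total, the
  right-hand side vanishes for all \<open>b\<close> exactly when \<open>P x (id - V V\<^sup>\<dagger>) = 0\<close>.  So \<open>x\<close> lies in the
  ternary domain if and only if \<open>P x = P x V V\<^sup>\<dagger>\<close>.  Substituting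
  \<open>\<Phi> x = W\<^sup>\<dagger> (P x) V\<close> into the other two conditions turns one into the image of this equation under
  the injective \<open>W\<^sup>\<dagger>\<close> and the other into the equation itself, because \<open>W W\<^sup>\<dagger> = id\<close>.
\<close>

lemma cinner_adj_right:
  fixes T :: "'a::chilbert_space \<Rightarrow>\<^sub>C\<^sub>L 'b::chilbert_space"
  shows "cinner x (cop_apply (T\<^sup>\<dagger>) y) = cinner (cop_apply T x) y"
  by (metis cinner_adj cinner_commute)

lemma cop_bounded_linear: "bounded_linear (cop_apply T)"
proof -
  obtain K where "\<forall>x. norm (cop_apply T x) \<le> norm x * K"
    using cop_bounded by blast
  then show ?thesis
    by (intro bounded_linear_intro[of _ K]) (auto simp: scaleR_scaleC)
qed

text \<open>The kernel of a bounded operator is a closed complex subspace, so it contains the closed span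
  of any set on which the operator vanishes.\<close>

lemma cop_eq_zero_if_total:
  assumes total: "closure (cspan S) = UNIV" and zero: "\<And>u. u \<in> S \<Longrightarrow> cop_apply T u = 0"
  shows "T = 0"
proof -
  have "complex_vector.subspace {u. cop_apply T u = 0}"
    using cop_scaleC[of T 0 0]
    by (auto simp: complex_vector.subspace_def)
  then have "cspan S \<subseteq> {u. cop_apply T u = 0}"
    using zero by (intro complex_vector.span_minimal) auto
  moreover have "closed {u. cop_apply T u = 0}"
    by (intro closed_Collect_eq continuous_on_const
        bounded_linear.continuous_on[OF cop_bounded_linear continuous_on_id])
  ultimately have "closure (cspan S) \<subseteq> {u. cop_apply T u = 0}"
    by (rule closure_minimal)
  then show ?thesis
    using total by (intro cop_eqI) auto
qed

lemma coisometry_adj_cancel: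
  assumes "coisometry W"
  shows "W (cop_apply (W\<^sup>\<dagger>) u) = u"
  using assms unfolding coisometry_def by (metis cop_compose_apply id_cop_apply)

lemma module_map_cinner:
  assumes "module_map ip \<phi> \<Phi>"
  shows "cinner (cop_apply (\<Phi> x) h) (cop_apply (\<Phi> y) k) = cinner h (\<phi> (ip x y) k)"
proof -
  have "\<phi> (ip x y) k = ((\<Phi> x)\<^sup>\<dagger>) (\<Phi> y k)"
    using assms unfolding module_map_def by (metis cop_compose_apply)
  then show ?thesis
    by (simp add: cinner_adj_right)
qed

text \<open>
  With \<open>u = P (x b) h\<close> and \<open>v = P x (\<pi> b h)\<close>, each of the four inner products in the expansion
  of \<open>\<parallel>u - v\<parallel>\<^sup>2\<close> equals \<open>\<langle>h, \<pi> (b\<^sup>* \<langle>x, x\<rangle> b) h\<rangle>\<close>, so they cancel.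
\<close>

lemma module_representation_act:
  assumes "hilbert_module act ip" and "module_representation ip \<pi> P"
  shows "P (act x b) = P x o\<^sub>C\<^sub>L \<pi> b"
proof (rule cop_eqI)
  fix h
  interpret hilbert_module act ip by fact
  have mult: "\<pi> (a * c) = \<pi> a o\<^sub>C\<^sub>L \<pi> c" and star: "\<pi> (star a) = (\<pi> a)\<^sup>\<dagger>" for a c
    using assms(2) by (auto simp: module_representation_def star_representation_def)
  have P: "cinner (P y k) (P z l) = cinner k (\<pi> (ip y z) l)" for y z k l
    using assms(2) by (intro module_map_cinner) (simp add: module_representation_def)
  have ip_act_left: "ip (act y a) z = star a * ip y z" for y z a
    by (metis ip_star ip_act_right star_mult)
  define u v where "u = P (act x b) h" and "v = P x (\<pi> b h)"
  have "cinner (u - v) (u - v) = 0"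
    by (simp add: u_def v_def cinner_diff_left cinner_diff_right P ip_act_left ip_act_right
        mult star cinner_adj_right)
  then have "u = v"
    by (simp add: cinner_self)
  then show "P (act x b) h = (P x o\<^sub>C\<^sub>L \<pi> b) h"
    by (simp add: u_def v_def)
qed

lemma ternary_domain_iff_stinespring:
  assumes "hilbert_module act ip" and "minimal_stinespring ip \<phi> \<Phi> P \<pi> W V"
  shows "x \<in> ternary_domain act \<phi> \<Phi> \<longleftrightarrow> P x o\<^sub>C\<^sub>L (id_cop - V o\<^sub>C\<^sub>L V\<^sup>\<dagger>) = 0"
proof -
  have rep: "module_representation ip \<pi> P" and W: "coisometry W"
    and \<phi>: "\<And>a. \<phi> a = V\<^sup>\<dagger> o\<^sub>C\<^sub>L \<pi> a o\<^sub>C\<^sub>L V" and \<Phi>: "\<And>x. \<Phi> x = W\<^sup>\<dagger> o\<^sub>C\<^sub>L P x o\<^sub>C\<^sub>L V"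
    and total: "closure (cspan {\<pi> a (V h) | a h. True}) = UNIV"
    using assms(2) by (auto simp: minimal_stinespring_def)
  have W_inj: "(W\<^sup>\<dagger>) u = (W\<^sup>\<dagger>) v \<longleftrightarrow> u = v" for u v
    by (metis coisometry_adj_cancel[OF W])
  let ?T = "P x o\<^sub>C\<^sub>L (id_cop - V o\<^sub>C\<^sub>L V\<^sup>\<dagger>)"
  have T: "?T u = P x u - P x (V ((V\<^sup>\<dagger>) u))" for u
    using bounded_linear.linear[OF cop_bounded_linear[of "P x"]] by (simp add: linear_diff)
  have "x \<in> ternary_domain act \<phi> \<Phi> \<longleftrightarrow> (\<forall>b h. ?T (\<pi> b (V h)) = 0)"
    unfolding T
    by (simp add: ternary_domain_def cop_eq_iff \<phi> \<Phi> W_inj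
        module_representation_act[OF assms(1) rep])
  also have "\<dots> \<longleftrightarrow> ?T = 0"
  proof
    assume zero: "\<forall>b h. ?T (\<pi> b (V h)) = 0"
    show "?T = 0"
      by (rule cop_eq_zero_if_total[OF total]) (use zero in blast)
  qed simp
  finally show ?thesis .
qed

theorem corollary4p7:
  fixes act :: "'x::cbanach \<Rightarrow> 'a::cstar_algebra \<Rightarrow> 'x"
    and ip :: "'x \<Rightarrow> 'x \<Rightarrow> 'a"
    and \<phi> :: "'a \<Rightarrow> ('h::chilbert_space \<Rightarrow>\<^sub>C\<^sub>L 'h)"
    and \<Phi> :: "'x \<Rightarrow> ('h \<Rightarrow>\<^sub>C\<^sub>L 'k::chilbert_space)"
    and P :: "'x \<Rightarrow> ('hp::chilbert_space \<Rightarrow>\<^sub>C\<^sub>L 'kp::chilbert_space)"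
    and \<pi> :: "'a \<Rightarrow> ('hp \<Rightarrow>\<^sub>C\<^sub>L 'hp)"
    and W :: "'k \<Rightarrow>\<^sub>C\<^sub>L 'kp"
    and V :: "'h \<Rightarrow>\<^sub>C\<^sub>L 'hp"
    and x :: 'x
  assumes "hilbert_module act ip"
    and "clinear \<phi>" and "completely_positive \<phi>"
    and "module_map ip \<phi> \<Phi>"
    and "minimal_stinespring ip \<phi> \<Phi> P \<pi> W V"
  shows "(x \<in> ternary_domain act \<phi> \<Phi> \<longleftrightarrow> P x o\<^sub>C\<^sub>L (id_cop - V o\<^sub>C\<^sub>L V\<^sup>\<dagger>) = 0)
    \<and> (x \<in> ternary_domain act \<phi> \<Phi> \<longleftrightarrow> W\<^sup>\<dagger> o\<^sub>C\<^sub>L P x = \<Phi> x o\<^sub>C\<^sub>L V\<^sup>\<dagger>)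
    \<and> (x \<in> ternary_domain act \<phi> \<Phi> \<longleftrightarrow> P x = W o\<^sub>C\<^sub>L \<Phi> x o\<^sub>C\<^sub>L V\<^sup>\<dagger>)"
proof -
  have W: "coisometry W" and \<Phi>: "\<Phi> x = W\<^sup>\<dagger> o\<^sub>C\<^sub>L P x o\<^sub>C\<^sub>L V"
    using assms(5) by (auto simp: minimal_stinespring_def)
  note cancel = coisometry_adj_cancel[OF W]
  have two: "P x o\<^sub>C\<^sub>L (id_cop - V o\<^sub>C\<^sub>L V\<^sup>\<dagger>) = 0 \<longleftrightarrow> (\<forall>u. P x u = P x (V ((V\<^sup>\<dagger>) u)))"
    using bounded_linear.linear[OF cop_bounded_linear[of "P x"]]
    by (simp add: cop_eq_iff linear_diff)
  have three: "W\<^sup>\<dagger> o\<^sub>C\<^sub>L P x = \<Phi> x o\<^sub>C\<^sub>L V\<^sup>\<dagger> \<longleftrightarrow> (\<forall>u. P x u = P x (V ((V\<^sup>\<dagger>) u)))"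
    unfolding cop_eq_iff \<Phi> cop_compose_apply by (metis cancel)
  have four: "P x = W o\<^sub>C\<^sub>L \<Phi> x o\<^sub>C\<^sub>L V\<^sup>\<dagger> \<longleftrightarrow> (\<forall>u. P x u = P x (V ((V\<^sup>\<dagger>) u)))"
    by (simp add: cop_eq_iff \<Phi> cancel)
  show ?thesis
    using ternary_domain_iff_stinespring[OF assms(1,5)] two three four by blast
qed

end
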